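(* Let $\Omega\subset X$ be open, $u\in\mathcal A(\Omega)$ and let $p\ge1$ be an integer. Then $$\mathcal S^{(a,\mathcal F)}_{\mathcal A}(u^p)\subset\{(x,r): x\in\mathcal S^{\mathcal F}_{\mathcal A}(u),\ r\in H_{p,x}(u)\},$$ where $$H_{p,x}(u)=\begin{cases}[0,\ p\,\sup\Sigma_x(u)] & \text{if }\Sigma_x(u)\neq\mathbb R_+,\\ \mathbb R_+ & \text{if }\Sigma_x(u)=\mathbb R_+.\end{cases}$$
   Context: $\mathbb K=\mathbb R$ or $\mathbb C$, $\mathbb R_+=[0,\infty)$. The algebra. $\Lambda$ is an index set; $A$ is a solid subring of $\mathbb K^\Lambda$ (if $(s_\lambda)\in\mathbb K^\Lambda$, $(r_\lambda)\in A$ and $|s_\lambda|\le|r_\lambda|$ for all $\lambda$, then $(s_\lambda)\in A$); $I_A$ is a solid ideal of $A$ (same property with $I_A$ in place of $A$). $\mathcal E$ is a sheaf of topological $\mathbb K$-algebras over a topological space $X$. For each open $\Omega\subset X$ the topology of $\mathcal E(\Omega)$ is given by a family of seminorms $\mathcal P(\Omega)=(p_i)_{i\in I(\Omega)}$ such that: if $\Omega_1\subset\Omega_2$ are open then $I(\Omega_1)\subset I(\Omega_2)$ and, for each $p_i\in\mathcal P(\Omega_1)$, the seminorm $u\mapsto p_i(u|_{\Omega_1})$ belongs to $\mathcal P(\Omega_2)$ (it is the extension of $p_i$); and if $\Omega=\bigcup_{h\in H}\Omega_h$ with $\Omega_h$ open, then for each $p_i\in\mathcal P(\Omega)$ there are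 finitely many of the $\Omega_h$, say $\Omega_1,\dots,\Omega_{n}$, and seminorms $p_k\in\mathcal P(\Omega_k)$ with $p_i(u)\le\sum_{k=1}^n p_k(u|_{\Omega_k})$ for all $u\in\mathcal E(\Omega)$. With $|B|=\{(|r_\lambda|)_\lambda:(r_\lambda)_\lambda\in B\}$, set $\mathcal H(\Omega)=\{(u_\lambda)\in\mathcal E(\Omega)^\Lambda:\forall i\in I(\Omega),\ (p_i(u_\lambda))_\lambda\in|A|\}$, $\mathcal J(\Omega)=\{(u_\lambda)\in\mathcal E(\Omega)^\Lambda:\forall i\in I(\Omega),\ (p_i(u_\lambda))_\lambda\in|I_A|\}$ and $\mathcal A(\Omega)=\mathcal H(\Omega)/\mathcal J(\Omega)$, a presheaf of algebras; $[u_\lambda]$ is the class of $(u_\lambda)_\lambda$; restrictions and products are defined on representatives. Asymptotics. $A$ is unitary; $\Lambda$ is directed by a partial order $\prec$, and $\lim_\Lambda x_\lambda=x$ means: for each neighborhood $W$ of $x$ there is $\lambda_0\in\Lambda$ with $x_\lambda\in W$ for all $\lambda\prec\lambda_0$ (so any two elements of $\Lambda$ have a common predecessor). $\mathcal F$ is a presheaf of topological $\mathbb K$-algebras over $X$ (with continuous restriction maps) whose spaces $\mathcal F(V)$ are separated and locally convex, and which contains $\mathcal E$ as a subsheaf of topological algebras. It is assumed that for every open $V$ and every $(v_\lambda)\in\mathcal J(V)$, $\lim_\Lambda v_\lambda=0$ in $\mathcal F(V)$. $a:\mathbb R_+\to A_+=\{(b_\lambda)\in A: b_\lambda\ge0\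 \forall\lambda\}$, $a(r)=(a_\lambda(r))_\lambda$, satisfies $a(0)=1$, $a_\lambda(r+s)\le a_\lambda(r)a_\lambda(s)$ for all $r,s\in\mathbb R_+$ and all $\lambda$, and $\lim_\Lambda a_\lambda(r)=0$ for all $r>0$. Definitions. For $u=[u_\lambda]\in\mathcal A(\Omega)$ and $x\in\Omega$, let $\mathcal V_x$ be the set of open neighborhoods of $x$ (contained in $\Omega$). $\mathcal S^{\mathcal F}_{\mathcal A}(u)$ (the $\mathcal F$-singular support) is the set of $x\in\Omega$ for which there is no $V\in\mathcal V_x$ such that $\lim_\Lambda u_\lambda|_V$ exists in $\mathcal F(V)$. $N_x(u)=\{r\in\mathbb R_+:\exists V\in\mathcal V_x,\ \exists f\in\mathcal F(V):\ \lim_\Lambda a_\lambda(r)u_\lambda|_V=f\text{ in }\mathcal F(V)\}$, $\Sigma_x(u)=\mathbb R_+\setminus N_x(u)$, and the $(a,\mathcal F)$-singular spectrum is $\mathcal S^{(a,\mathcal F)}_{\mathcal A}(u)=\{(x,r)\in\Omega\times\mathbb R_+: r\in\Sigma_x(u)\}$. All these are independent of the representative. *)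

theory Defs
  imports "HOL-Analysis.Analysis" "HOL-Algebra.QuotRing" "HOL-Algebra.Module" "HOL-Algebra.Subrings"
begin

text \<open>
  The field of scalars is a type of class \<open>real_normed_field\<close>.  Up to isometric isomorphism
  the only such fields are the reals and the complex numbers (Gelfand--Mazur).

  The index set is a type of class \<open>order\<close>.  The filter \<^const>\<open>at_bot\<close> is generated by
  the sets of all \<open>l\<close> below a given \<open>l0\<close>; by the lemma \<open>limitin_at_bot_iff\<close> below, for a
  downward directed order, limits along it are the limits "for all \<open>l\<close> preceding some \<open>l0\<close>".
\<close>

lemma eventually_at_bot_directed:
  fixes P :: "'l::order \<Rightarrow> bool"
  assumes "\<And>j k :: 'l. \<exists>m. m \<le> j \<and> m \<le> k"
  shows "eventually P at_bot \<longleftrightarrow> (\<exists>l0. \<forall>l\<le>l0. P l)"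
  unfolding at_bot_def
proof (subst eventually_INF_base)
  fix j k :: 'l
  obtain m where "m \<le> j" "m \<le> k"
    using assms by blast
  then show "\<exists>x\<in>UNIV. principal {..x} \<le> inf (principal {..j}) (principal {..k})"
    by (intro bexI[of _ m]) auto
qed (auto simp: eventually_principal)

lemma limitin_at_bot_iff:
  fixes f :: "'l::order \<Rightarrow> 's"
  assumes "\<And>j k :: 'l. \<exists>m. m \<le> j \<and> m \<le> k"
  shows "limitin T f y at_bot \<longleftrightarrow>
    y \<in> topspace T \<and> (\<forall>W. openin T W \<and> y \<in> W \<longrightarrow> (\<exists>l0. \<forall>l\<le>l0. f l \<in> W))"
  unfolding limitin_def by (simp add: eventually_at_bot_directed[OF assms])


subsection \<open>Algebras and topological algebras\<close>

definition scalar_ring :: "'k::real_normed_field ring" where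
  "scalar_ring = \<lparr>carrier = UNIV, mult = (*), one = 1, zero = 0, add = (+)\<rparr>"

text \<open>
  Associative algebras, neither assumed commutative nor unital: the field \<open>one\<close> of the record
  is never used.
\<close>

locale K_algebra = module scalar_ring M
  for M :: "('k::real_normed_field, 's) module" (structure) +
  assumes mult_closed: "\<lbrakk>u \<in> carrier M; v \<in> carrier M\<rbrakk> \<Longrightarrow> u \<otimes> v \<in> carrier M"
    and mult_assoc: "\<lbrakk>u \<in> carrier M; v \<in> carrier M; w \<in> carrier M\<rbrakk>
      \<Longrightarrow> (u \<otimes> v) \<otimes> w = u \<otimes> (v \<otimes> w)"
    and distrib_right: "\<lbrakk>u \<in> carrier M; v \<in> carrier M; w \<in> carrier M\<rbrakk>
      \<Longrightarrow> (u \<oplus> v) \<otimes> w = u \<otimes> w \<oplus> v \<otimes> w"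
    and distrib_left: "\<lbrakk>u \<in> carrier M; v \<in> carrier M; w \<in> carrier M\<rbrakk>
      \<Longrightarrow> u \<otimes> (v \<oplus> w) = u \<otimes> v \<oplus> u \<otimes> w"
    and smult_mult_left: "\<lbrakk>u \<in> carrier M; v \<in> carrier M\<rbrakk> \<Longrightarrow> (c \<odot> u) \<otimes> v = c \<odot> (u \<otimes> v)"
    and smult_mult_right: "\<lbrakk>u \<in> carrier M; v \<in> carrier M\<rbrakk> \<Longrightarrow> u \<otimes> (c \<odot> v) = c \<odot> (u \<otimes> v)"

definition algebra_hom ::
    "('k::real_normed_field, 's) module \<Rightarrow> ('k, 't) module \<Rightarrow> ('s \<Rightarrow> 't) set" where
  "algebra_hom M N = {h. h \<in> carrier M \<rightarrow> carrier N \<and>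
     (\<forall>u\<in>carrier M. \<forall>v\<in>carrier M.
        h (u \<oplus>\<^bsub>M\<^esub> v) = h u \<oplus>\<^bsub>N\<^esub> h v \<and> h (u \<otimes>\<^bsub>M\<^esub> v) = h u \<otimes>\<^bsub>N\<^esub> h v) \<and>
     (\<forall>c. \<forall>u\<in>carrier M. h (c \<odot>\<^bsub>M\<^esub> u) = c \<odot>\<^bsub>N\<^esub> h u)}"

text \<open>
  The power \<open>u\<^sup>n\<close> for \<open>n \<ge> 1\<close>, with \<open>u\<^sup>1 = u\<close>; the library power on ring records starts
  from \<open>one\<close>, which is not available here.
\<close>

definition alg_pow :: "('a, 'm) ring_scheme \<Rightarrow> 'a \<Rightarrow> nat \<Rightarrow> 'a" where
  "alg_pow R u n = ((\<lambda>v. v \<otimes>\<^bsub>R\<^esub> u) ^^ (n - 1)) u"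

locale topological_K_algebra = K_algebra M
  for M :: "('k::real_normed_field, 's) module" (structure) and T :: "'s topology" +
  assumes topspace_eq: "topspace T = carrier M"
    and continuous_add: "continuous_map (prod_topology T T) T (\<lambda>(u, v). u \<oplus> v)"
    and continuous_mult: "continuous_map (prod_topology T T) T (\<lambda>(u, v). u \<otimes> v)"
    and continuous_smult: "continuous_map (prod_topology euclidean T) T (\<lambda>(c, u). c \<odot> u)"

definition convex_in :: "('k::real_normed_field, 's) module \<Rightarrow> 's set \<Rightarrow> bool" where
  "convex_in M C \<longleftrightarrow> C \<subseteq> carrier M \<and>
     (\<forall>u\<in>C. \<forall>v\<in>C. \<forall>t\<in>{0..1}. of_real t \<odot>\<^bsub>M\<^esub> u \<oplus>\<^bsub>M\<^esub> of_real (1 - t) \<odot>\<^bsub>M\<^esub> v \<in> C)"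

definition locally_convex_in ::
    "('k::real_normed_field, 's) module \<Rightarrow> 's topology \<Rightarrow> bool" where
  "locally_convex_in M T \<longleftrightarrow>
     (\<forall>U. openin T U \<and> \<zero>\<^bsub>M\<^esub> \<in> U \<longrightarrow>
        (\<exists>C W. convex_in M C \<and> openin T W \<and> \<zero>\<^bsub>M\<^esub> \<in> W \<and> W \<subseteq> C \<and> C \<subseteq> U))"

definition seminorm_on :: "('k::real_normed_field, 's) module \<Rightarrow> ('s \<Rightarrow> real) \<Rightarrow> bool" where
  "seminorm_on M q \<longleftrightarrow>
     (\<forall>u\<in>carrier M. 0 \<le> q u) \<and>
     (\<forall>u\<in>carrier M. \<forall>v\<in>carrier M. q (u \<oplus>\<^bsub>M\<^esub> v) \<le> q u + q v) \<and>
     (\<forall>c. \<forall>u\<in>carrier M. q (c \<odot>\<^bsub>M\<^esub> u) = norm c * q u)"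

definition seminorm_topology ::
    "('k::real_normed_field, 's) module \<Rightarrow> 'i set \<Rightarrow> ('i \<Rightarrow> 's \<Rightarrow> real) \<Rightarrow> 's topology" where
  "seminorm_topology M J q = topology_generated_by
     (insert (carrier M)
       {{v \<in> carrier M. q i (v \<ominus>\<^bsub>M\<^esub> u) < e} | i u e. i \<in> J \<and> u \<in> carrier M \<and> 0 < e})"


subsection \<open>Presheaves and sheaves of topological algebras\<close>

locale topological_algebra_presheaf =
  fixes X :: "'x topology"
    and M :: "'x set \<Rightarrow> ('k::real_normed_field, 's) module"
    and T :: "'x set \<Rightarrow> 's topology"
    and res :: "'x set \<Rightarrow> 'x set \<Rightarrow> 's \<Rightarrow> 's"
  assumes topological_algebra: "openin X U \<Longrightarrow> topological_K_algebra (M U) (T U)"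
    and res_hom: "\<lbrakk>openin X U; openin X V; V \<subseteq> U\<rbrakk> \<Longrightarrow> res U V \<in> algebra_hom (M U) (M V)"
    and res_continuous: "\<lbrakk>openin X U; openin X V; V \<subseteq> U\<rbrakk>
      \<Longrightarrow> continuous_map (T U) (T V) (res U V)"
    and res_self: "\<lbrakk>openin X U; u \<in> carrier (M U)\<rbrakk> \<Longrightarrow> res U U u = u"
    and res_res: "\<lbrakk>openin X U; openin X V; openin X W; W \<subseteq> V; V \<subseteq> U; u \<in> carrier (M U)\<rbrakk>
      \<Longrightarrow> res V W (res U V u) = res U W u"

locale topological_algebra_sheaf = topological_algebra_presheaf +
  assumes locality:
      "\<lbrakk>\<And>V. V \<in> \<C> \<Longrightarrow> openin X V; U = \<Union>\<C>; u \<in> carrier (M U); v \<in> carrier (M U);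
        \<And>V. V \<in> \<C> \<Longrightarrow> res U V u = res U V v\<rbrakk> \<Longrightarrow> u = v"
    and gluing:
      "\<lbrakk>\<And>V. V \<in> \<C> \<Longrightarrow> openin X V; U = \<Union>\<C>; \<And>V. V \<in> \<C> \<Longrightarrow> s V \<in> carrier (M V);
        \<And>V W. \<lbrakk>V \<in> \<C>; W \<in> \<C>\<rbrakk> \<Longrightarrow> res V (V \<inter> W) (s V) = res W (V \<inter> W) (s W)\<rbrakk>
       \<Longrightarrow> \<exists>u\<in>carrier (M U). \<forall>V\<in>\<C>. res U V u = s V"

text \<open>
  A sheaf whose topologies are given by families of seminorms \<open>(p U i)\<close>, \<open>i \<in> I U\<close>, subject to
  the two compatibility conditions with restrictions.  In the second one, repetitions among the
  \<open>h m\<close> are allowed.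
\<close>

locale seminormed_algebra_sheaf =
  topological_algebra_sheaf X E "\<lambda>U. seminorm_topology (E U) (I U) (p U)" res
  for X :: "'x topology"
    and E :: "'x set \<Rightarrow> ('k::real_normed_field, 's) module"
    and I :: "'x set \<Rightarrow> 'i set"
    and p :: "'x set \<Rightarrow> 'i \<Rightarrow> 's \<Rightarrow> real"
    and res :: "'x set \<Rightarrow> 'x set \<Rightarrow> 's \<Rightarrow> 's" +
  assumes seminorms: "\<lbrakk>openin X U; i \<in> I U\<rbrakk> \<Longrightarrow> seminorm_on (E U) (p U i)"
    and index_mono: "\<lbrakk>openin X U; openin X V; V \<subseteq> U\<rbrakk> \<Longrightarrow> I V \<subseteq> I U"
    and seminorm_extension:
      "\<lbrakk>openin X U; openin X V; V \<subseteq> U; i \<in> I V\<rbrakk>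
       \<Longrightarrow> \<exists>j\<in>I U. \<forall>u\<in>carrier (E U). p U j u = p V i (res U V u)"
    and seminorm_cover:
      "\<lbrakk>\<And>V. V \<in> \<C> \<Longrightarrow> openin X V; U = \<Union>\<C>; i \<in> I U\<rbrakk>
       \<Longrightarrow> \<exists>(n::nat) h k. (\<forall>m<n. h m \<in> \<C> \<and> k m \<in> I (h m)) \<and>
             (\<forall>u\<in>carrier (E U). p U i u \<le> (\<Sum>m<n. p (h m) (k m) (res U (h m) u)))"


subsection \<open>The algebras of asymptotic type\<close>

definition family_ring :: "('l \<Rightarrow> 'k::real_normed_field) ring" where
  "family_ring = \<lparr>carrier = UNIV, mult = (\<lambda>r s l. r l * s l), one = (\<lambda>l. 1),
     zero = (\<lambda>l. 0), add = (\<lambda>r s l. r l + s l)\<rparr>"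

definition solid :: "('l \<Rightarrow> 'k::real_normed_field) set \<Rightarrow> bool" where
  "solid B \<longleftrightarrow> (\<forall>s r. r \<in> B \<and> (\<forall>l. norm (s l) \<le> norm (r l)) \<longrightarrow> s \<in> B)"

definition abs_families :: "('l \<Rightarrow> 'k::real_normed_field) set \<Rightarrow> ('l \<Rightarrow> real) set" where
  "abs_families B = {\<lambda>l. norm (r l) | r. r \<in> B}"

definition nonneg_families :: "('l \<Rightarrow> 'k::real_normed_field) set \<Rightarrow> ('l \<Rightarrow> real) set" where
  "nonneg_families A = {b. (\<lambda>l. of_real (b l)) \<in> A \<and> (\<forall>l. 0 \<le> b l)}"

text \<open>
  With \<open>B = A\<close> this is \<open>\<H>(U)\<close>, with \<open>B = I\<^sub>A\<close> it is \<open>\<J>(U)\<close>.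
\<close>

definition moderate_families ::
    "('x set \<Rightarrow> ('k::real_normed_field, 's) module) \<Rightarrow> ('x set \<Rightarrow> 'i set) \<Rightarrow>
     ('x set \<Rightarrow> 'i \<Rightarrow> 's \<Rightarrow> real) \<Rightarrow> ('l \<Rightarrow> 'k) set \<Rightarrow> 'x set \<Rightarrow> ('l \<Rightarrow> 's) set" where
  "moderate_families E I p B U =
     {u. (\<forall>l. u l \<in> carrier (E U)) \<and> (\<forall>i\<in>I U. (\<lambda>l. p U i (u l)) \<in> abs_families B)}"

definition moderate_algebra ::
    "('x set \<Rightarrow> ('k::real_normed_field, 's) module) \<Rightarrow> ('x set \<Rightarrow> 'i set) \<Rightarrow>
     ('x set \<Rightarrow> 'i \<Rightarrow> 's \<Rightarrow> real) \<Rightarrow> ('l \<Rightarrow> 'k) set \<Rightarrow> 'x set \<Rightarrow> ('k, 'l \<Rightarrow> 's) module" where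
  "moderate_algebra E I p A U =
     \<lparr>carrier = moderate_families E I p A U,
      mult = (\<lambda>u v l. u l \<otimes>\<^bsub>E U\<^esub> v l), one = (\<lambda>l. \<one>\<^bsub>E U\<^esub>),
      zero = (\<lambda>l. \<zero>\<^bsub>E U\<^esub>), add = (\<lambda>u v l. u l \<oplus>\<^bsub>E U\<^esub> v l),
      smult = (\<lambda>c u l. c \<odot>\<^bsub>E U\<^esub> u l)\<rparr>"

text \<open>
  \<open>\<A>(U) = \<H>(U) / \<J>(U)\<close>: an element is a coset, i.e. the set of all its representatives.
\<close>

definition asymptotic_algebra ::
    "('x set \<Rightarrow> ('k::real_normed_field, 's) module) \<Rightarrow> ('x set \<Rightarrow> 'i set) \<Rightarrow>
     ('x set \<Rightarrow> 'i \<Rightarrow> 's \<Rightarrow> real) \<Rightarrow> ('l \<Rightarrow> 'k) set \<Rightarrow> ('l \<Rightarrow> 'k) set \<Rightarrow> 'x set \<Rightarrow>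
     ('l \<Rightarrow> 's) set ring" where
  "asymptotic_algebra E I p A IA U =
     moderate_algebra E I p A U Quot moderate_families E I p IA U"


subsection \<open>Standing assumptions\<close>

locale asymptotic_setting =
  E: seminormed_algebra_sheaf X E I p resE +
  F: topological_algebra_presheaf X F TF resF
  for X :: "'x topology"
    and E :: "'x set \<Rightarrow> ('k::real_normed_field, 's) module"
    and I :: "'x set \<Rightarrow> 'i set"
    and p :: "'x set \<Rightarrow> 'i \<Rightarrow> 's \<Rightarrow> real"
    and resE :: "'x set \<Rightarrow> 'x set \<Rightarrow> 's \<Rightarrow> 's"
    and F :: "'x set \<Rightarrow> ('k, 's) module"
    and TF :: "'x set \<Rightarrow> 's topology"
    and resF :: "'x set \<Rightarrow> 'x set \<Rightarrow> 's \<Rightarrow> 's" +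
  fixes A IA :: "('l::order \<Rightarrow> 'k) set"
    and a :: "real \<Rightarrow> 'l \<Rightarrow> real"
  assumes directed: "\<exists>m. m \<le> (j::'l) \<and> m \<le> k"
    and A_subring: "subring A family_ring"
    and A_solid: "solid A"
    and IA_ideal: "ideal IA (family_ring\<lparr>carrier := A\<rparr>)"
    and IA_solid: "solid IA"
    and F_separated: "openin X U \<Longrightarrow> Hausdorff_space (TF U)"
    and F_locally_convex: "openin X U \<Longrightarrow> locally_convex_in (F U) (TF U)"
    and E_subset: "openin X U \<Longrightarrow> carrier (E U) \<subseteq> carrier (F U)"
    and E_inclusion_hom: "openin X U \<Longrightarrow> (\<lambda>u. u) \<in> algebra_hom (E U) (F U)"
    and E_inclusion_continuous: "openin X U \<Longrightarrow>
      continuous_map (seminorm_topology (E U) (I U) (p U)) (TF U) (\<lambda>u. u)"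
    and E_res_eq: "\<lbrakk>openin X U; openin X V; V \<subseteq> U; u \<in> carrier (E U)\<rbrakk>
      \<Longrightarrow> resE U V u = resF U V u"
    and negligible_tendsto_zero:
      "\<lbrakk>openin X U; v \<in> moderate_families E I p IA U\<rbrakk> \<Longrightarrow> limitin (TF U) v \<zero>\<^bsub>F U\<^esub> at_bot"
    and a_nonneg_families: "0 \<le> r \<Longrightarrow> a r \<in> nonneg_families A"
    and a_zero: "a 0 = (\<lambda>l. 1)"
    and a_submult: "\<lbrakk>0 \<le> r; 0 \<le> s\<rbrakk> \<Longrightarrow> a (r + s) l \<le> a r l * a s l"
    and a_tendsto_zero: "0 < r \<Longrightarrow> (a r \<longlongrightarrow> 0) at_bot"


subsection \<open>Singular support and singular spectrum\<close>

text \<open>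
  Here \<open>u\<close> is a coset, and \<open>w \<in> u\<close> is a representative of it.  By
  \<open>limit_independent_of_representative\<close> below the choice of \<open>w\<close> does not matter (for the
  singular support take \<open>r = 0\<close>).
\<close>

definition singular_support ::
    "'x topology \<Rightarrow> ('x set \<Rightarrow> 's topology) \<Rightarrow> ('x set \<Rightarrow> 'x set \<Rightarrow> 's \<Rightarrow> 's) \<Rightarrow>
     'x set \<Rightarrow> ('l::order \<Rightarrow> 's) set \<Rightarrow> 'x set" where
  "singular_support X TF res \<Omega> u =
     {x \<in> \<Omega>. \<not> (\<exists>V. openin X V \<and> x \<in> V \<and> V \<subseteq> \<Omega> \<and>
        (\<exists>w\<in>u. \<exists>f. limitin (TF V) (\<lambda>l. res \<Omega> V (w l)) f at_bot))}"

definition regular_exponents ::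
    "'x topology \<Rightarrow> ('x set \<Rightarrow> ('k::real_normed_field, 's) module) \<Rightarrow>
     ('x set \<Rightarrow> 's topology) \<Rightarrow> ('x set \<Rightarrow> 'x set \<Rightarrow> 's \<Rightarrow> 's) \<Rightarrow> (real \<Rightarrow> 'l::order \<Rightarrow> real) \<Rightarrow>
     'x set \<Rightarrow> ('l \<Rightarrow> 's) set \<Rightarrow> 'x \<Rightarrow> real set" where
  "regular_exponents X F TF res a \<Omega> u x =
     {r. 0 \<le> r \<and> (\<exists>V. openin X V \<and> x \<in> V \<and> V \<subseteq> \<Omega> \<and>
        (\<exists>w\<in>u. \<exists>f. limitin (TF V) (\<lambda>l. of_real (a r l) \<odot>\<^bsub>F V\<^esub> res \<Omega> V (w l)) f at_bot))}"

definition singular_exponents ::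
    "'x topology \<Rightarrow> ('x set \<Rightarrow> ('k::real_normed_field, 's) module) \<Rightarrow>
     ('x set \<Rightarrow> 's topology) \<Rightarrow> ('x set \<Rightarrow> 'x set \<Rightarrow> 's \<Rightarrow> 's) \<Rightarrow> (real \<Rightarrow> 'l::order \<Rightarrow> real) \<Rightarrow>
     'x set \<Rightarrow> ('l \<Rightarrow> 's) set \<Rightarrow> 'x \<Rightarrow> real set" where
  "singular_exponents X F TF res a \<Omega> u x = {0..} - regular_exponents X F TF res a \<Omega> u x"

definition singular_spectrum ::
    "'x topology \<Rightarrow> ('x set \<Rightarrow> ('k::real_normed_field, 's) module) \<Rightarrow>
     ('x set \<Rightarrow> 's topology) \<Rightarrow> ('x set \<Rightarrow> 'x set \<Rightarrow> 's \<Rightarrow> 's) \<Rightarrow> (real \<Rightarrow> 'l::order \<Rightarrow> real) \<Rightarrow>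
     'x set \<Rightarrow> ('l \<Rightarrow> 's) set \<Rightarrow> ('x \<times> real) set" where
  "singular_spectrum X F TF res a \<Omega> u =
     {(x, r). x \<in> \<Omega> \<and> 0 \<le> r \<and> r \<in> singular_exponents X F TF res a \<Omega> u x}"

text \<open>
  The first case is only of interest for \<open>x\<close> in the singular support of \<open>u\<close>; then \<open>0\<close> is a
  singular exponent, so the supremum is over a nonempty set.
\<close>

definition power_bound ::
    "'x topology \<Rightarrow> ('x set \<Rightarrow> ('k::real_normed_field, 's) module) \<Rightarrow>
     ('x set \<Rightarrow> 's topology) \<Rightarrow> ('x set \<Rightarrow> 'x set \<Rightarrow> 's \<Rightarrow> 's) \<Rightarrow> (real \<Rightarrow> 'l::order \<Rightarrow> real) \<Rightarrow>
     'x set \<Rightarrow> ('l \<Rightarrow> 's) set \<Rightarrow> nat \<Rightarrow> 'x \<Rightarrow> real set" where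
  "power_bound X F TF res a \<Omega> u n x =
     (let S = singular_exponents X F TF res a \<Omega> u x
      in if S \<noteq> {0..} then {0..real n * Sup S} else {0..})"

lemma limitin_add_K:
  assumes "topological_K_algebra M T" "limitin T f y G" "limitin T g z G"
  shows "limitin T (\<lambda>l. f l \<oplus>\<^bsub>M\<^esub> g l) (y \<oplus>\<^bsub>M\<^esub> z) G"
proof -
  interpret topological_K_algebra M T by fact
  have "limitin (prod_topology T T) (\<lambda>l. (f l, g l)) (y, z) G"
    using assms(2,3) by (simp add: limitin_pairwise o_def)
  from continuous_map_limit[OF continuous_add this] show ?thesis
    by (simp add: o_def)
qed

lemma limitin_smult_K:
  assumes "topological_K_algebra M T" "limitin T f y G"
  shows "limitin T (\<lambda>l. c \<odot>\<^bsub>M\<^esub> f l) (c \<odot>\<^bsub>M\<^esub> y) G"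
proof -
  interpret topological_K_algebra M T by fact
  have "limitin (prod_topology euclidean T) (\<lambda>l. (c, f l)) (c, y) G"
    using assms(2) by (simp add: limitin_pairwise o_def)
  from continuous_map_limit[OF continuous_smult this] show ?thesis
    by (simp add: o_def)
qed

context asymptotic_setting
begin

lemma scaled_restriction_negligible:
  assumes "openin X \<Omega>" "openin X V" "V \<subseteq> \<Omega>" "0 \<le> r"
    and v: "v \<in> moderate_families E I p IA \<Omega>"
  shows "(\<lambda>l. of_real (a r l) \<odot>\<^bsub>E V\<^esub> resE \<Omega> V (v l)) \<in> moderate_families E I p IA V"
proof -
  interpret EV: topological_K_algebra "E V" "seminorm_topology (E V) (I V) (p V)"
    using E.topological_algebra assms(2) .
  interpret IA: ideal IA "family_ring\<lparr>carrier := A\<rparr>"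
    by (rule IA_ideal)
  have res: "resE \<Omega> V (v l) \<in> carrier (E V)" for l
    using E.res_hom[OF assms(1-3)] v by (auto simp: algebra_hom_def moderate_families_def)
  have aA: "(\<lambda>l. of_real (a r l)) \<in> A" and a0: "0 \<le> a r l" for l
    using a_nonneg_families[OF \<open>0 \<le> r\<close>] by (auto simp: nonneg_families_def)
  have "(\<lambda>l. p V i (of_real (a r l) \<odot>\<^bsub>E V\<^esub> resE \<Omega> V (v l))) \<in> abs_families IA"
    if i: "i \<in> I V" for i
  proof -
    obtain j where j: "j \<in> I \<Omega>" "\<And>u. u \<in> carrier (E \<Omega>) \<Longrightarrow> p \<Omega> j u = p V i (resE \<Omega> V u)"
      using E.seminorm_extension[OF assms(1-3) i] by blast
    obtain s where s: "s \<in> IA" "(\<lambda>l. p \<Omega> j (v l)) = (\<lambda>l. norm (s l))"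
      using v j(1) by (auto simp: moderate_families_def abs_families_def)
    have "(\<lambda>l. of_real (a r l) * s l) \<in> IA"
      using IA.I_l_closed[of s "\<lambda>l. of_real (a r l)"] s(1) aA by (simp add: family_ring_def)
    moreover have "p V i (of_real (a r l) \<odot>\<^bsub>E V\<^esub> resE \<Omega> V (v l)) = norm (of_real (a r l) * s l)" for l
    proof -
      have "p V i (resE \<Omega> V (v l)) = norm (s l)"
        using j(2)[of "v l"] v fun_cong[OF s(2), of l] by (auto simp: moderate_families_def)
      then show ?thesis
        using E.seminorms[OF assms(2) i] res[of l] by (simp add: seminorm_on_def norm_mult)
    qed
    ultimately show ?thesis
      unfolding abs_families_def by auto
  qed
  moreover have "of_real (a r l) \<odot>\<^bsub>E V\<^esub> resE \<Omega> V (v l) \<in> carrier (E V)" for l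
    using EV.smult_closed res by (simp add: scalar_ring_def)
  ultimately show ?thesis
    by (auto simp: moderate_families_def)
qed

theorem limit_independent_of_representative:
  assumes "openin X \<Omega>" "openin X V" "V \<subseteq> \<Omega>" "0 \<le> r"
    and u: "u \<in> carrier (asymptotic_algebra E I p A IA \<Omega>)" "w \<in> u" "w' \<in> u"
    and lim: "limitin (TF V) (\<lambda>l. of_real (a r l) \<odot>\<^bsub>F V\<^esub> resE \<Omega> V (w l)) f at_bot"
  shows "limitin (TF V) (\<lambda>l. of_real (a r l) \<odot>\<^bsub>F V\<^esub> resE \<Omega> V (w' l)) f at_bot"
proof -
  interpret FV: topological_K_algebra "F V" "TF V"
    using F.topological_algebra assms(2) .
  let ?J = "moderate_families E I p IA \<Omega>"
  let ?g = "\<lambda>v l. of_real (a r l) \<odot>\<^bsub>F V\<^esub> resE \<Omega> V (v l)"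
  obtain h where h: "h \<in> moderate_families E I p A \<Omega>" "u = {\<lambda>l. j l \<oplus>\<^bsub>E \<Omega>\<^esub> h l | j. j \<in> ?J}"
    using u(1) by (auto simp: asymptotic_algebra_def FactRing_simps moderate_algebra_def
        a_r_coset_def r_coset_def)
  obtain j j' where j: "j \<in> ?J" "w = (\<lambda>l. j l \<oplus>\<^bsub>E \<Omega>\<^esub> h l)"
    and j': "j' \<in> ?J" "w' = (\<lambda>l. j' l \<oplus>\<^bsub>E \<Omega>\<^esub> h l)"
    using u(2,3) h(2) by auto
  have carr: "v l \<in> carrier (E \<Omega>)" "resE \<Omega> V (v l) \<in> carrier (E V)"
    "resE \<Omega> V (v l) \<in> carrier (F V)" "?g v l \<in> carrier (F V)"
    if "v \<in> moderate_families E I p B \<Omega>" for v l B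
  proof -
    show 1: "v l \<in> carrier (E \<Omega>)"
      using that by (auto simp: moderate_families_def)
    then show 2: "resE \<Omega> V (v l) \<in> carrier (E V)"
      using E.res_hom[OF assms(1-3)] by (auto simp: algebra_hom_def)
    then show 3: "resE \<Omega> V (v l) \<in> carrier (F V)"
      using E_subset assms(2) by blast
    then show "?g v l \<in> carrier (F V)"
      using FV.smult_closed by (simp add: scalar_ring_def)
  qed
  have negl: "limitin (TF V) (?g v) \<zero>\<^bsub>F V\<^esub> at_bot" if "v \<in> ?J" for v
  proof -
    have "(\<lambda>l. of_real (a r l) \<odot>\<^bsub>E V\<^esub> resE \<Omega> V (v l)) = ?g v"
      using E_inclusion_hom[OF assms(2)] carr[OF that] by (auto simp: algebra_hom_def)
    then show ?thesis
      using negligible_tendsto_zero[OF assms(2) scaled_restriction_negligible[OF assms(1-4) that]]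
      by simp
  qed
  have split: "?g (\<lambda>l. v l \<oplus>\<^bsub>E \<Omega>\<^esub> h l) l = ?g v l \<oplus>\<^bsub>F V\<^esub> ?g h l" if "v \<in> ?J" for v l
  proof -
    have "resE \<Omega> V (v l \<oplus>\<^bsub>E \<Omega>\<^esub> h l) = resE \<Omega> V (v l) \<oplus>\<^bsub>E V\<^esub> resE \<Omega> V (h l)"
      using E.res_hom[OF assms(1-3)] carr(1)[OF that] carr(1)[OF h(1)]
      by (auto simp: algebra_hom_def)
    also have "\<dots> = resE \<Omega> V (v l) \<oplus>\<^bsub>F V\<^esub> resE \<Omega> V (h l)"
      using E_inclusion_hom[OF assms(2)] carr(2)[OF that] carr(2)[OF h(1)]
      by (auto simp: algebra_hom_def)
    finally show ?thesis
      using FV.smult_r_distr carr(3)[OF that] carr(3)[OF h(1)] by (simp add: scalar_ring_def)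
  qed
  let ?m = "(-1) :: 'k"
  have minus: "?m \<odot>\<^bsub>F V\<^esub> y \<oplus>\<^bsub>F V\<^esub> y = \<zero>\<^bsub>F V\<^esub>" if "y \<in> carrier (F V)" for y
    using FV.smult_l_distr[of ?m 1 y] FV.smult_one[of y] FV.smult_l_null[of y] that
    by (simp add: scalar_ring_def)
  have smc: "c \<odot>\<^bsub>F V\<^esub> y \<in> carrier (F V)" if "y \<in> carrier (F V)" for c y
    using FV.smult_closed[of c y] that by (simp add: scalar_ring_def)
  have "limitin (TF V) (\<lambda>l. ?g j' l \<oplus>\<^bsub>F V\<^esub> (?m \<odot>\<^bsub>F V\<^esub> ?g j l \<oplus>\<^bsub>F V\<^esub> ?g w l))
      (\<zero>\<^bsub>F V\<^esub> \<oplus>\<^bsub>F V\<^esub> (?m \<odot>\<^bsub>F V\<^esub> \<zero>\<^bsub>F V\<^esub> \<oplus>\<^bsub>F V\<^esub> f)) at_bot"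
    by (intro limitin_add_K limitin_smult_K negl j j' lim FV.topological_K_algebra_axioms)
  moreover have "?g j' l \<oplus>\<^bsub>F V\<^esub> (?m \<odot>\<^bsub>F V\<^esub> ?g j l \<oplus>\<^bsub>F V\<^esub> ?g w l) = ?g w' l" for l
  proof -
    have "?g w l = ?g j l \<oplus>\<^bsub>F V\<^esub> ?g h l" "?g w' l = ?g j' l \<oplus>\<^bsub>F V\<^esub> ?g h l"
      using split[OF j(1)] split[OF j'(1)] j(2) j'(2) by simp_all
    moreover have "?m \<odot>\<^bsub>F V\<^esub> ?g j l \<oplus>\<^bsub>F V\<^esub> (?g j l \<oplus>\<^bsub>F V\<^esub> ?g h l) = ?g h l"
      using FV.a_assoc[symmetric, OF smc[OF carr(4)[OF j(1)]] carr(4)[OF j(1)] carr(4)[OF h(1)]]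
        minus[OF carr(4)[OF j(1)]] FV.l_zero[OF carr(4)[OF h(1)]] by simp
    ultimately show ?thesis by simp
  qed
  moreover have "f \<in> carrier (F V)"
    using lim FV.topspace_eq by (auto simp: limitin_def)
  then have "\<zero>\<^bsub>F V\<^esub> \<oplus>\<^bsub>F V\<^esub> (?m \<odot>\<^bsub>F V\<^esub> \<zero>\<^bsub>F V\<^esub> \<oplus>\<^bsub>F V\<^esub> f) = f"
    using FV.smult_r_null[of ?m] by (simp add: scalar_ring_def)
  ultimately show ?thesis by simp
qed

end

end

theory Submission
  imports Defs
begin

text \<open>
  Write \<open>N(u)\<close> for the regular and \<open>\<Sigma>(u)\<close> for the singular exponents of \<open>u\<close> at a fixed point.
  Everything rests on one implication (\<open>regular_exponents_alg_pow\<close>): if \<open>s \<in> N(u)\<close> and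
  \<open>n s < r\<close>, then \<open>r \<in> N(u\<^sup>n)\<close>.  Indeed, if \<open>a\<^sub>l(s) u\<^sub>l\<close> converges near the point, so does its
  \<open>n\<close>-th power \<open>a\<^sub>l(s)\<^sup>n u\<^sub>l\<^sup>n\<close>, because multiplication is continuous; and submultiplicativity,
  \<open>a\<^sub>l(r) \<le> a\<^sub>l(r - n s) a\<^sub>l(s)\<^sup>n\<close>, gives \<open>a\<^sub>l(r) = c\<^sub>l a\<^sub>l(s)\<^sup>n\<close> with \<open>c\<^sub>l\<close> tending to \<open>0\<close>
  (\<open>scale_factor\<close>).  The strict inequality is essential: for \<open>r = n s\<close> the factor \<open>c\<^sub>l\<close> is only
  known to be bounded.  It may be relaxed to an equality when \<open>r = s = 0\<close>, as \<open>a(0) = 1\<close>.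

  The implication is used three times.  For \<open>n = 1\<close> it says that \<open>N(u)\<close> is upward closed, so
  that \<open>\<Sigma>(u)\<close> is bounded as soon as it is not the whole half-line.  Starting from \<open>s = 0\<close>, which is
  regular exactly off the singular support, it shows that off the singular support all exponents
  are regular for \<open>u\<^sup>n\<close>.  Finally, if \<open>r > n sup \<Sigma>(u)\<close>, a number \<open>s\<close> strictly between
  \<open>sup \<Sigma>(u)\<close> and \<open>r / n\<close> is regular for \<open>u\<close>, so that \<open>r\<close> is regular for \<open>u\<^sup>n\<close>.
\<close>

section \<open>Positive powers in an algebra\<close>

lemma alg_pow_1 [simp]: "alg_pow R u 1 = u" "alg_pow R u (Suc 0) = u"
  by (simp_all add: alg_pow_def)

lemma alg_pow_Suc: "1 \<le> n \<Longrightarrow> alg_pow R u (Suc n) = alg_pow R u n \<otimes>\<^bsub>R\<^esub> u"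
  by (cases n) (simp_all add: alg_pow_def)

context K_algebra
begin

lemma smult_in_carrier: "u \<in> carrier M \<Longrightarrow> c \<odot> u \<in> carrier M"
  using smult_closed[of c u] by (simp add: scalar_ring_def)

lemma smult_smult: "u \<in> carrier M \<Longrightarrow> c \<odot> (d \<odot> u) = (c * d) \<odot> u"
  using smult_assoc1[of c d u] by (simp add: scalar_ring_def)

lemma one_smult: "u \<in> carrier M \<Longrightarrow> 1 \<odot> u = u"
  using smult_one[of u] by (simp add: scalar_ring_def)

lemma alg_pow_closed: "\<lbrakk>1 \<le> n; u \<in> carrier M\<rbrakk> \<Longrightarrow> alg_pow M u n \<in> carrier M"
  by (induction n rule: nat_induct_at_least) (simp_all add: alg_pow_Suc mult_closed)

lemma alg_pow_smult:
  "\<lbrakk>1 \<le> n; u \<in> carrier M\<rbrakk> \<Longrightarrow> alg_pow M (c \<odot> u) n = c ^ n \<odot> alg_pow M u n"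
  by (induction n rule: nat_induct_at_least)
    (simp_all add: alg_pow_Suc smult_mult_left smult_mult_right alg_pow_closed
      mult_closed smult_in_carrier smult_smult mult.commute)

lemma alg_pow_hom:
  assumes "h \<in> algebra_hom M N" "1 \<le> n" "u \<in> carrier M"
  shows "h (alg_pow M u n) = alg_pow N (h u) n"
  using assms(2,3)
proof (induction n rule: nat_induct_at_least)
  case (Suc n)
  then show ?case
    using assms(1) alg_pow_closed[of n u] by (simp add: alg_pow_Suc algebra_hom_def)
qed simp

end

section \<open>Limits in a topological algebra\<close>

context topological_K_algebra
begin

lemma limitin_mult:
  assumes "limitin T f y G" "limitin T g z G"
  shows "limitin T (\<lambda>l. f l \<otimes> g l) (y \<otimes> z) G"
proof -
  have "limitin (prod_topology T T) (\<lambda>l. (f l, g l)) (y, z) G"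
    using assms by (simp add: limitin_pairwise o_def)
  from continuous_map_limit[OF continuous_mult this] show ?thesis
    by (simp add: o_def)
qed

lemma limitin_smult:
  assumes "(c \<longlongrightarrow> k) G" "limitin T f y G"
  shows "limitin T (\<lambda>l. c l \<odot> f l) (k \<odot> y) G"
proof -
  have "limitin (prod_topology euclidean T) (\<lambda>l. (c l, f l)) (k, y) G"
    using assms by (simp add: limitin_pairwise o_def)
  from continuous_map_limit[OF continuous_smult this] show ?thesis
    by (simp add: o_def)
qed

lemma limitin_alg_pow:
  assumes "1 \<le> n" "limitin T f y G"
  shows "limitin T (\<lambda>l. alg_pow M (f l) n) (alg_pow M y n) G"
  using assms(1)
  by (induction n rule: nat_induct_at_least) (simp_all add: alg_pow_Suc limitin_mult assms(2))

end

section \<open>Powers and regular exponents\<close>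

context asymptotic_setting
begin

lemma a_nonneg: "0 \<le> r \<Longrightarrow> 0 \<le> a r l"
  using a_nonneg_families[of r] by (simp add: nonneg_families_def)

lemma a_mult_le_power: "0 \<le> s \<Longrightarrow> a (real n * s) l \<le> a s l ^ n"
proof (induction n)
  case 0
  then show ?case by (simp add: a_zero)
next
  case (Suc n)
  have "a (real (Suc n) * s) l \<le> a s l * a (real n * s) l"
    using a_submult[of s "real n * s" l] Suc.prems by (simp add: algebra_simps)
  also have "\<dots> \<le> a s l * a s l ^ n"
    using Suc by (intro mult_left_mono a_nonneg) auto
  finally show ?case by simp
qed

text \<open>
  The quotient \<open>a\<^sub>l(r) / a\<^sub>l(s)\<^sup>n\<close> is dominated by \<open>a\<^sub>l(r - n s)\<close>, which tends to \<open>0\<close>.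
\<close>

lemma scale_factor:
  assumes "0 \<le> s" and r: "real n * s < r \<or> r = 0 \<and> s = 0"
  obtains c k where "(c \<longlongrightarrow> k) at_bot" "\<And>l. a r l = c l * a s l ^ n"
proof (cases "real n * s < r")
  case False
  then show thesis
    using r that[of "\<lambda>_. 1" 1] by (simp add: a_zero)
next
  case True
  let ?d = "r - real n * s"
  let ?c = "\<lambda>l. a r l / a s l ^ n"
  have pos: "0 \<le> real n * s"
    using assms(1) by simp
  with True have "0 \<le> r" by linarith
  have le: "a r l \<le> a ?d l * a s l ^ n" for l
  proof -
    have "a r l \<le> a ?d l * a (real n * s) l"
      using a_submult[of ?d "real n * s" l] True pos by simp
    also have "\<dots> \<le> a ?d l * a s l ^ n"
      using True assms(1) by (intro mult_left_mono a_mult_le_power a_nonneg) auto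
    finally show ?thesis .
  qed
  have c_bounds: "0 \<le> ?c l" "?c l \<le> a ?d l" for l
  proof -
    show "0 \<le> ?c l"
      using \<open>0 \<le> r\<close> assms(1) by (simp add: a_nonneg)
    show "?c l \<le> a ?d l"
    proof (cases "a s l ^ n = 0")
      case True
      then show ?thesis
        using a_nonneg[of ?d l] \<open>real n * s < r\<close> by (simp only: div_by_0)
    next
      case False
      then have "0 < a s l ^ n"
        using a_nonneg[OF assms(1), of l] zero_le_power[of "a s l" n] by linarith
      then show ?thesis
        using le[of l] by (simp only: pos_divide_le_eq)
    qed
  qed
  have "(?c \<longlongrightarrow> 0) at_bot"
    using True c_bounds
    by (intro tendsto_sandwich[OF _ _ tendsto_const a_tendsto_zero[of ?d]]) auto
  moreover have "a r l = ?c l * a s l ^ n" for l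
  \<comment> \<open>where the denominator vanishes, so does the numerator\<close>
  proof (cases "a s l ^ n = 0")
    case True
    then have "a r l \<le> 0"
      using le[of l] by (simp only: mult_zero_right)
    then show ?thesis
      using a_nonneg[OF \<open>0 \<le> r\<close>, of l] True by (simp only: mult_zero_right)
  next
    case False
    then show ?thesis
      by (rule nonzero_eq_divide_eq[THEN iffD1, OF _ refl, symmetric])
  qed
  ultimately show thesis
    by (rule that)
qed

lemma representative_in_carrier:
  assumes "openin X \<Omega>" "u \<in> carrier (asymptotic_algebra E I p A IA \<Omega>)" "w \<in> u"
  shows "w l \<in> carrier (E \<Omega>)"
proof -
  interpret topological_K_algebra "E \<Omega>" "seminorm_topology (E \<Omega>) (I \<Omega>) (p \<Omega>)"
    using E.topological_algebra assms(1) .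
  show ?thesis
    using assms(2,3)
    by (auto simp: asymptotic_algebra_def FactRing_simps moderate_algebra_def
        a_r_coset_def r_coset_def moderate_families_def)
qed

lemma zero_negligible:
  assumes "openin X \<Omega>"
  shows "(\<lambda>l. \<zero>\<^bsub>E \<Omega>\<^esub>) \<in> moderate_families E I p IA \<Omega>"
proof -
  interpret topological_K_algebra "E \<Omega>" "seminorm_topology (E \<Omega>) (I \<Omega>) (p \<Omega>)"
    using E.topological_algebra assms .
  interpret IA: ideal IA "family_ring\<lparr>carrier := A\<rparr>"
    by (rule IA_ideal)
  have zero_IA: "(\<lambda>l. 0) \<in> IA"
    using additive_subgroup.zero_closed[OF IA.additive_subgroup_axioms]
    by (simp add: family_ring_def)
  have "p \<Omega> i \<zero>\<^bsub>E \<Omega>\<^esub> = 0" if "i \<in> I \<Omega>" for i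
  proof -
    have "p \<Omega> i (0 \<odot>\<^bsub>E \<Omega>\<^esub> \<zero>\<^bsub>E \<Omega>\<^esub>) = norm (0 :: 'k) * p \<Omega> i \<zero>\<^bsub>E \<Omega>\<^esub>"
      using E.seminorms[OF assms that] unfolding seminorm_on_def by blast
    then show ?thesis
      using smult_r_null[of 0] by (simp add: scalar_ring_def)
  qed
  then show ?thesis
    using zero_IA by (auto simp: moderate_families_def abs_families_def intro!: exI[of _ "\<lambda>l. 0"])
qed

text \<open>
  Multiplication of cosets contains the pointwise products of representatives, since \<open>0\<close> is
  negligible.
\<close>

lemma alg_pow_representative:
  assumes "openin X \<Omega>" "u \<in> carrier (asymptotic_algebra E I p A IA \<Omega>)" "w \<in> u" "1 \<le> n"
  shows "(\<lambda>l. alg_pow (E \<Omega>) (w l) n) \<in> alg_pow (asymptotic_algebra E I p A IA \<Omega>) u n"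
  using assms(4)
proof (induction n rule: nat_induct_at_least)
  case base
  then show ?case using assms(3) by simp
next
  case (Suc n)
  interpret topological_K_algebra "E \<Omega>" "seminorm_topology (E \<Omega>) (I \<Omega>) (p \<Omega>)"
    using E.topological_algebra assms(1) .
  let ?H = "moderate_algebra E I p A \<Omega>" and ?J = "moderate_families E I p IA \<Omega>"
  let ?U = "alg_pow (asymptotic_algebra E I p A IA \<Omega>) u"
  let ?v = "\<lambda>l. alg_pow (E \<Omega>) (w l) n"
  have "?v l \<otimes>\<^bsub>E \<Omega>\<^esub> w l \<in> carrier (E \<Omega>)" for l
    using representative_in_carrier[OF assms(1-3)] Suc.hyps
    by (intro mult_closed alg_pow_closed) auto
  then have "(\<lambda>l. ?v l \<otimes>\<^bsub>E \<Omega>\<^esub> w l) \<in> ?J +>\<^bsub>?H\<^esub> (?v \<otimes>\<^bsub>?H\<^esub> w)"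
    unfolding a_r_coset_def r_coset_def moderate_algebra_def
    by (auto intro!: bexI[OF _ zero_negligible[OF assms(1)]])
  moreover have "?U (Suc n) = rcoset_mult ?H ?J (?U n) u"
    using Suc.hyps by (simp add: alg_pow_Suc asymptotic_algebra_def FactRing_simps)
  moreover have "(\<lambda>l. alg_pow (E \<Omega>) (w l) (Suc n)) = (\<lambda>l. ?v l \<otimes>\<^bsub>E \<Omega>\<^esub> w l)"
    using Suc.hyps by (simp add: alg_pow_Suc)
  ultimately show ?case
    using Suc.IH assms(3) unfolding rcoset_mult_def by auto
qed

text \<open>
  A limit of \<open>a(s) u\<close> near \<open>x\<close> gives one of \<open>a(s)\<^sup>n u\<^sup>n\<close>, by continuity of the product, and the
  factor between \<open>a(s)\<^sup>n\<close> and \<open>a(r)\<close> converges.  The case \<open>r = s = 0\<close> states that \<open>u\<^sup>n\<close>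
  converges wherever \<open>u\<close> does.
\<close>

lemma regular_exponents_alg_pow:
  assumes \<Omega>: "openin X \<Omega>" and u: "u \<in> carrier (asymptotic_algebra E I p A IA \<Omega>)"
    and n: "1 \<le> n"
    and s: "s \<in> regular_exponents X F TF resE a \<Omega> u x"
    and r: "real n * s < r \<or> r = 0 \<and> s = 0"
  shows "r \<in> regular_exponents X F TF resE a \<Omega>
    (alg_pow (asymptotic_algebra E I p A IA \<Omega>) u n) x"
proof -
  obtain V w f where V: "openin X V" "x \<in> V" "V \<subseteq> \<Omega>" and w: "w \<in> u" and "0 \<le> s"
    and lim: "limitin (TF V) (\<lambda>l. of_real (a s l) \<odot>\<^bsub>F V\<^esub> resE \<Omega> V (w l)) f at_bot"
    using s by (auto simp: regular_exponents_def)
  interpret E\<Omega>: topological_K_algebra "E \<Omega>" "seminorm_topology (E \<Omega>) (I \<Omega>) (p \<Omega>)"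
    using E.topological_algebra \<Omega> .
  interpret EV: topological_K_algebra "E V" "seminorm_topology (E V) (I V) (p V)"
    using E.topological_algebra V(1) .
  interpret FV: topological_K_algebra "F V" "TF V"
    using F.topological_algebra V(1) .
  obtain c k where c: "(c \<longlongrightarrow> k) at_bot" "\<And>l. a r l = c l * a s l ^ n"
    using scale_factor[OF \<open>0 \<le> s\<close> r] by blast
  have res: "resE \<Omega> V \<in> algebra_hom (E \<Omega>) (E V)"
    using E.res_hom[OF \<Omega> V(1,3)] .
  have w_carr: "w l \<in> carrier (E \<Omega>)" for l
    using representative_in_carrier[OF \<Omega> u w] .
  then have resw_E: "resE \<Omega> V (w l) \<in> carrier (E V)" for l
    using res unfolding algebra_hom_def by (blast dest: funcset_mem)
  then have resw_F: "resE \<Omega> V (w l) \<in> carrier (F V)" for l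
    using E_subset[OF V(1)] by blast
  have "resE \<Omega> V (alg_pow (E \<Omega>) (w l) n) = alg_pow (F V) (resE \<Omega> V (w l)) n" for l
    using E\<Omega>.alg_pow_hom[OF res n w_carr] EV.alg_pow_hom[OF E_inclusion_hom[OF V(1)] n resw_E]
    by simp
  then have "of_real (c l) \<odot>\<^bsub>F V\<^esub> alg_pow (F V) (of_real (a s l) \<odot>\<^bsub>F V\<^esub> resE \<Omega> V (w l)) n
      = of_real (a r l) \<odot>\<^bsub>F V\<^esub> resE \<Omega> V (alg_pow (E \<Omega>) (w l) n)" for l
    using n resw_F
    by (simp add: FV.alg_pow_smult FV.smult_smult FV.alg_pow_closed c(2))
  moreover have "limitin (TF V)
      (\<lambda>l. of_real (c l) \<odot>\<^bsub>F V\<^esub> alg_pow (F V) (of_real (a s l) \<odot>\<^bsub>F V\<^esub> resE \<Omega> V (w l)) n)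
      (of_real k \<odot>\<^bsub>F V\<^esub> alg_pow (F V) f n) at_bot"
    by (intro FV.limitin_smult FV.limitin_alg_pow tendsto_of_real c(1) n lim)
  ultimately have "limitin (TF V)
      (\<lambda>l. of_real (a r l) \<odot>\<^bsub>F V\<^esub> resE \<Omega> V (alg_pow (E \<Omega>) (w l) n))
      (of_real k \<odot>\<^bsub>F V\<^esub> alg_pow (F V) f n) at_bot"
    by simp
  moreover have "0 \<le> r"
  proof -
    have "0 \<le> real n * s" using \<open>0 \<le> s\<close> by simp
    with r show ?thesis by linarith
  qed
  ultimately show ?thesis
    unfolding regular_exponents_def mem_Collect_eq
    by (intro conjI exI[of _ V] bexI[OF _ alg_pow_representative[OF \<Omega> u w n]]
        exI[of _ "of_real k \<odot>\<^bsub>F V\<^esub> alg_pow (F V) f n"] V)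
qed

lemma singular_support_iff_zero_singular:
  assumes \<Omega>: "openin X \<Omega>" and u: "u \<in> carrier (asymptotic_algebra E I p A IA \<Omega>)"
    and "x \<in> \<Omega>"
  shows "x \<in> singular_support X TF resE \<Omega> u
    \<longleftrightarrow> 0 \<in> singular_exponents X F TF resE a \<Omega> u x"
proof -
  have "of_real (a 0 l) \<odot>\<^bsub>F V\<^esub> resE \<Omega> V (w l) = resE \<Omega> V (w l)"
    if V: "openin X V" "V \<subseteq> \<Omega>" and w: "w \<in> u" for V w l
  proof -
    interpret FV: topological_K_algebra "F V" "TF V"
      using F.topological_algebra V(1) .
    have "resE \<Omega> V (w l) \<in> carrier (F V)"
      using E.res_hom[OF \<Omega> V] representative_in_carrier[OF \<Omega> u w, of l] E_subset[OF V(1)]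
      by (auto simp: algebra_hom_def)
    then show ?thesis
      by (simp add: a_zero FV.one_smult)
  qed
  then show ?thesis
    using assms(3)
    by (simp add: singular_support_def singular_exponents_def regular_exponents_def
        cong: conj_cong bex_cong)
qed

text \<open>
  The case \<open>n = 1\<close> of the result on powers: a singular \<open>s\<close> above a regular \<open>t\<close> would be regular.
\<close>

lemma singular_exponent_le_regular_exponent:
  assumes \<Omega>: "openin X \<Omega>" and u: "u \<in> carrier (asymptotic_algebra E I p A IA \<Omega>)"
    and "s \<in> singular_exponents X F TF resE a \<Omega> u x"
    and "t \<in> regular_exponents X F TF resE a \<Omega> u x"
  shows "s \<le> t"
proof (rule ccontr)
  assume "\<not> s \<le> t"
  then have "s \<in> regular_exponents X F TF resE a \<Omega> u x"
    using regular_exponents_alg_pow[OF \<Omega> u order_refl assms(4), of s] by simp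
  then show False
    using assms(3) by (simp add: singular_exponents_def)
qed

theorem singular_spectrum_alg_pow:
  assumes \<Omega>: "openin X \<Omega>" and u: "u \<in> carrier (asymptotic_algebra E I p A IA \<Omega>)"
    and n: "1 \<le> n"
  shows "singular_spectrum X F TF resE a \<Omega> (alg_pow (asymptotic_algebra E I p A IA \<Omega>) u n)
    \<subseteq> {(x, r). x \<in> singular_support X TF resE \<Omega> u \<and>
               r \<in> power_bound X F TF resE a \<Omega> u n x}"
proof clarify
  fix x r
  assume xr: "(x, r) \<in> singular_spectrum X F TF resE a \<Omega>
    (alg_pow (asymptotic_algebra E I p A IA \<Omega>) u n)"
  then have "x \<in> \<Omega>" "0 \<le> r"
    by (auto simp: singular_spectrum_def)
  let ?N = "regular_exponents X F TF resE a \<Omega> u x"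
  let ?S = "singular_exponents X F TF resE a \<Omega> u x"
  have not_regular: "\<not> (real n * s < r \<or> r = 0 \<and> s = 0)" if "s \<in> ?N" for s
    using regular_exponents_alg_pow[OF \<Omega> u n that, of r] xr
    by (auto simp: singular_spectrum_def singular_exponents_def)
  have "0 \<in> ?S"
    using not_regular[of 0] \<open>0 \<le> r\<close> by (auto simp: singular_exponents_def)
  moreover have "r \<le> real n * Sup ?S" if "?S \<noteq> {0..}"
  proof (rule ccontr)
    assume "\<not> r \<le> real n * Sup ?S"
    then have "Sup ?S < r / real n"
      using n by (simp add: field_simps)
    then obtain s where s: "Sup ?S < s" "s < r / real n"
      using dense by blast
    obtain t where "t \<in> ?N"
      using \<open>?S \<noteq> {0..}\<close> by (auto simp: singular_exponents_def)
    then have bdd: "bdd_above ?S"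
      using singular_exponent_le_regular_exponent[OF \<Omega> u] by (intro bdd_aboveI)
    have "0 \<le> s"
      using cSup_upper[OF \<open>0 \<in> ?S\<close> bdd] s(1) by simp
    moreover have "s \<notin> ?S"
      using cSup_upper[OF _ bdd, of s] s(1) by auto
    ultimately have "s \<in> ?N"
      by (simp add: singular_exponents_def)
    then show False
      using not_regular[of s] s(2) n by (simp add: field_simps)
  qed
  ultimately show "x \<in> singular_support X TF resE \<Omega> u \<and>
      r \<in> power_bound X F TF resE a \<Omega> u n x"
    using singular_support_iff_zero_singular[OF \<Omega> u \<open>x \<in> \<Omega>\<close>] \<open>0 \<le> r\<close>
    by (auto simp: power_bound_def Let_def)
qed

end

theorem corollary16:
  fixes X :: "'x topology"
    and E F :: "'x set \<Rightarrow> ('k::real_normed_field, 's) module"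
    and I :: "'x set \<Rightarrow> 'i set"
    and q :: "'x set \<Rightarrow> 'i \<Rightarrow> 's \<Rightarrow> real"
    and resE resF :: "'x set \<Rightarrow> 'x set \<Rightarrow> 's \<Rightarrow> 's"
    and TF :: "'x set \<Rightarrow> 's topology"
    and A IA :: "('l::order \<Rightarrow> 'k) set"
    and a :: "real \<Rightarrow> 'l \<Rightarrow> real"
    and \<Omega> :: "'x set"
    and u :: "('l \<Rightarrow> 's) set"
    and p :: nat
  assumes "asymptotic_setting X E I q resE F TF resF A IA a"
    and "openin X \<Omega>"
    and "u \<in> carrier (asymptotic_algebra E I q A IA \<Omega>)"
    and "1 \<le> p"
  shows "singular_spectrum X F TF resE a \<Omega> (alg_pow (asymptotic_algebra E I q A IA \<Omega>) u p)
    \<subseteq> {(x, r). x \<in> singular_support X TF resE \<Omega> u \<and>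
               r \<in> power_bound X F TF resE a \<Omega> u p x}"
  using asymptotic_setting.singular_spectrum_alg_pow assms .

end
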